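(* Let $N,K\ge1$ and $1\le M\le T$ be integers and consider a network of $N$ individuals with bot set $\mathcal B=\{B_1,\dots,B_K\}$, bot $B_k$ having strength $\eta_{B_k}\in(0,1]$. Let $\widetilde S_N=[\widetilde s_{ij}]_{i,j=1}^N$ and the $N\times K$ matrix $\widetilde S_{\mathcal B}=[\widetilde s_{iB_k}]$ have nonnegative entries with $\sum_{j=1}^N\widetilde s_{ij}+\sum_{k=1}^K\widetilde s_{iB_k}=1$ for all $i\in\{1,\dots,N\}$, and let the full interaction matrix be $\begin{bmatrix}\widetilde S_N&\widetilde S_{\mathcal B}\\ 0_{K\times N}&I_{K\times K}\end{bmatrix}$. Assume the network is connected and every bot influences at least one individual (for each $k$ there is $i$ with $\widetilde s_{iB_k}>0$). Let $c_{2,M}\in(-1/M,1/M)\setminus\{0\}$ and let $c_{1,M}$ satisfy $\max(0,-c_{2,M}m)\le c_{1,M}\le\min(1,1-c_{2,M}m)$ for all $m\in\{0,\dots,M\}$. Let the memory sets be $\mathcal M_{ji}^{(t)}=\{t-k_{ji}^{(1)},\dots,t-k_{ji}^{(M)}\}$ with integers $1\le k_{ji}^{(1)}<\cdots<k_{ji}^{(M)}\le T$ for all $i,j\in\{1,\dots,N\}$. Put $p^{( * )}=c_{1,M}/(1-c_{2,M}M)$ and $P^{( * )}=p^{( * )}\mathbf 1_N$, and let $P^{(\mathcal B,* )}\in\mathbb R^N$ be the fixed point of the belief dynamics in the presence of the bots. Suppose $\eta_{B_k}\ne p^{( * )}$ for at least one $k\in\{1,\dots,K\}$. Then $$(P^{(\mathcal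 B,* )}-P^{( * )})=\mathbf 0_N\iff\widetilde S_{\mathcal B}\,\boldsymbol\eta_{p^{( * )}}=\mathbf 0_N,$$ where $\boldsymbol\eta_{p^{( * )}}:=[\eta_{B_1}-p^{( * )},\dots,\eta_{B_K}-p^{( * )}]^{\mathbf T}$.
   Context: $\mathbf 1_N,\mathbf 0_N$ are the all-ones and all-zeros column vectors of length $N$. "Connected" means that the underlying undirected graph on individuals and bots (edge from $j$ to $i$ iff $\widetilde s_{ij}>0$, from $B_k$ to $i$ iff $\widetilde s_{iB_k}>0$) is connected. Model: for $i,j\in\{1,\dots,N\}$ the relative bias is $X^{(\mathcal B)}_{ij,t}=c_{1,M}+c_{2,M}\sum_{n\in\mathcal M_{ji}^{(t)}}Z^{(\mathcal B)}_{j,n}$, where $Z^{(\mathcal B)}_{j,n}\in\{0,1\}$ is the opinion expressed by $j$ at time $n$, and $Z^{(\mathcal B)}_{i,t}=1$ with conditional probability $\sum_{j=1}^N\widetilde s_{ij}X^{(\mathcal B)}_{ij,t-1}+\sum_{k=1}^K\widetilde s_{iB_k}\eta_{B_k}$. The beliefs $P^{(\mathcal B)}_i(t)=P(Z^{(\mathcal B)}_{i,t}=1)$ satisfy, for $i\in\{1,\dots,N\}$, $$P_i^{(\mathcal B)}(t)=c_{2,M}\sum_{j=1}^N\sum_{n\in\mathcal M_{ji}^{(t-1)}}\widetilde s_{ij}P_j^{(\mathcal B)}(n)+c_{1,M}\sum_{j=1}^N\widetilde s_{ij}+\sum_{k=1}^K\widetilde s_{iB_k}\eta_{B_k}.$$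 $P^{(\mathcal B,* )}$ is the unique fixed point of this recursion, i.e. the unique vector $P\in\mathbb R^N$ such that the constant sequence $P^{(\mathcal B)}(t)=P$ satisfies it; equivalently (as $|\mathcal M_{ji}^{(t-1)}|=M$), $P_i=c_{2,M}M\sum_j\widetilde s_{ij}P_j+c_{1,M}\sum_j\widetilde s_{ij}+\sum_k\widetilde s_{iB_k}\eta_{B_k}$ for all $i$. $P^{( * )}=p^{( * )}\mathbf 1_N$ is the fixed point of the corresponding dynamics without bots (row-stochastic interaction matrix, same $c_{1,M},c_{2,M}$ and memory sets). *)

theory Defs
  imports "HOL-Analysis.Analysis" "Graph_Theory.Digraph_Component"
begin

text \<open>
  Individuals are the elements of a finite type \<open>'n\<close> and bots those of a finite type
  \<open>'k\<close>, so that \<open>N = CARD('n)\<close> and \<open>K = CARD('k)\<close>.  Throughout, \<open>S $ i $ j\<close> is the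
  influence of individual \<open>j\<close> on individual \<open>i\<close>, and \<open>SB $ i $ k\<close> that of bot \<open>k\<close> on \<open>i\<close>.
\<close>

definition full_interaction ::
    "real^'n^'n \<Rightarrow> real^'k^'n \<Rightarrow> real^('n::finite + 'k::finite)^('n + 'k)" where
  "full_interaction S SB =
     (\<chi> u v. case (u, v) of
        (Inl i, Inl j) \<Rightarrow> S $ i $ j
      | (Inl i, Inr k) \<Rightarrow> SB $ i $ k
      | (Inr k, Inl j) \<Rightarrow> 0
      | (Inr k, Inr l) \<Rightarrow> mat 1 $ k $ l)"

text \<open>
  The entry in row \<open>u\<close> and column \<open>v\<close> yields an arc from \<open>v\<close> to \<open>u\<close>.  The identity block
  contributes only a loop at each bot, which does not affect connectedness.
\<close>

definition interaction_graph ::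
    "real^'n^'n \<Rightarrow> real^'k^'n \<Rightarrow> ('n::finite + 'k::finite) pair_pre_digraph" where
  "interaction_graph S SB =
     \<lparr> pverts = UNIV, parcs = {(v, u). full_interaction S SB $ u $ v > 0} \<rparr>"

text \<open>
  \<^const>\<open>Digraph_Component.connected\<close> means that the underlying undirected graph is connected;
  the unqualified name may be taken for topological connectedness.
\<close>

abbreviation connected_network ::
    "real^'n^'n \<Rightarrow> real^'k^'n::finite \<Rightarrow> bool" where
  "connected_network S SB \<equiv>
     Digraph_Component.connected (with_proj (interaction_graph S SB))"

text \<open>
  \<open>lag j i l\<close> is the \<open>l\<close>-th lag, for \<open>l \<in> {1..M}\<close>, of the memory that \<open>i\<close> has of \<open>j\<close>.
  Time is integer-valued, so that subtracting lags never truncates; the values of the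
  beliefs at times \<open>t \<le> 0\<close> serve as the initial history.
\<close>

definition memory_set ::
    "nat \<Rightarrow> ('n \<Rightarrow> 'n \<Rightarrow> nat \<Rightarrow> nat) \<Rightarrow> 'n \<Rightarrow> 'n \<Rightarrow> int \<Rightarrow> int set" where
  "memory_set M lag j i t = (\<lambda>l. t - int (lag j i l)) ` {1..M}"

definition belief_recursion ::
    "nat \<Rightarrow> ('n \<Rightarrow> 'n \<Rightarrow> nat \<Rightarrow> nat) \<Rightarrow> real \<Rightarrow> real \<Rightarrow> real^'n^'n \<Rightarrow> real^'k^'n \<Rightarrow> real^'k
      \<Rightarrow> (int \<Rightarrow> real^'n::finite) \<Rightarrow> bool" where
  "belief_recursion M lag c1 c2 S SB \<eta> P \<longleftrightarrow>
     (\<forall>t>0. \<forall>i. P t $ i =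
        c2 * (\<Sum>j\<in>UNIV. \<Sum>n\<in>memory_set M lag j i (t - 1). S $ i $ j * P n $ j)
        + c1 * (\<Sum>j\<in>UNIV. S $ i $ j)
        + (\<Sum>k\<in>UNIV. SB $ i $ k * \<eta> $ k))"

definition belief_fixed_point ::
    "nat \<Rightarrow> ('n \<Rightarrow> 'n \<Rightarrow> nat \<Rightarrow> nat) \<Rightarrow> real \<Rightarrow> real \<Rightarrow> real^'n^'n \<Rightarrow> real^'k^'n \<Rightarrow> real^'k
      \<Rightarrow> real^'n::finite" where
  "belief_fixed_point M lag c1 c2 S SB \<eta> =
     (THE P. belief_recursion M lag c1 c2 S SB \<eta> (\<lambda>t. P))"

end

(*
  Since every memory set has M elements, the fixed points are the solutions of the linear system
  P - a S P = c1 S 1 + SB eta with a = c2 M. As |a| < 1 and S is substochastic, id - a S is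
  injective, hence bijective, so the fixed point exists and is unique. Because p = a p + c1 and
  the rows of [S SB] sum to 1, the residual of the constant vector p 1 in this system is
  SB (eta - p 1), so p 1 is the fixed point exactly when this residual vanishes.
*)
theory Submission
  imports Defs
begin

text \<open>Strictly increasing lags are distinct, so subtracting them from \<open>t\<close> gives
  no repetitions.\<close>

lemma card_memory_set:
  assumes "strict_mono_on {1..M} (lag j i)"
  shows "card (memory_set M lag j i t) = M"
proof -
  have "inj_on (\<lambda>l. t - int (lag j i l)) {1..M}"
  proof (rule inj_onI)
    fix x y
    assume "x \<in> {1..M}" "y \<in> {1..M}" "t - int (lag j i x) = t - int (lag j i y)"
    moreover from this have "lag j i x = lag j i y" by linarith
    ultimately show "x = y"
      using strict_mono_on_imp_inj_on[OF assms] by (meson inj_onD)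
  qed
  from card_image[OF this] show ?thesis
    by (simp add: memory_set_def)
qed

text \<open>For a constant sequence each inner sum adds \<open>M\<close> equal terms, whichever lags
  occur, so lags and time both drop out. The literal \<open>1\<close> is the all-ones vector, so
  \<open>S *v 1\<close> lists the row sums of \<open>S\<close>.\<close>

lemma belief_recursion_const_iff:
  fixes S :: "real^'n^'n" and SB :: "real^'k^'n"
  assumes "\<And>i j. strict_mono_on {1..M} (lag j i)"
  shows "belief_recursion M lag c1 c2 S SB \<eta> (\<lambda>t. P) \<longleftrightarrow>
           P - (c2 * real M) *\<^sub>R (S *v P) = c1 *\<^sub>R (S *v 1) + SB *v \<eta>"
proof -
  have sum_eq: "c2 * (\<Sum>j\<in>UNIV. \<Sum>n\<in>memory_set M lag j i t. S $ i $ j * P $ j)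
          = c2 * real M * (\<Sum>j\<in>UNIV. S $ i $ j * P $ j)" for i t
    by (simp add: card_memory_set[OF assms] sum_distrib_left mult.assoc)
  have "\<exists>t::int. t > 0"
    by (rule exI[of _ 1]) simp
  then have "belief_recursion M lag c1 c2 S SB \<eta> (\<lambda>t. P) \<longleftrightarrow>
     (\<forall>i. P $ i = c2 * real M * (\<Sum>j\<in>UNIV. S $ i $ j * P $ j)
        + c1 * (\<Sum>j\<in>UNIV. S $ i $ j) + (\<Sum>k\<in>UNIV. SB $ i $ k * \<eta> $ k))"
    unfolding belief_recursion_def sum_eq by blast
  then show ?thesis
    by (simp add: vec_eq_iff matrix_vector_mult_def diff_eq_eq add.commute add.left_commute)
qed

text \<open>A maximum-norm argument: averaging with nonnegative weights of total at most 1 cannot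
  raise the largest absolute entry \<open>m\<close>, and the factor \<open>a\<close> shrinks it, so
  \<open>m \<le> \<bar>a\<bar> * m\<close>, which forces \<open>m = 0\<close>.\<close>

lemma substochastic_contraction_eq_0:
  fixes S :: "real^'n^'n"
  assumes nonneg: "\<And>i j. 0 \<le> S $ i $ j" and row: "\<And>i. (\<Sum>j\<in>UNIV. S $ i $ j) \<le> 1"
    and a: "\<bar>a\<bar> < 1" and x: "x = a *\<^sub>R (S *v x)"
  shows "x = 0"
proof -
  define m where "m = Max (range (\<lambda>i. \<bar>x $ i\<bar>))"
  have le_m: "\<bar>x $ i\<bar> \<le> m" for i
    unfolding m_def by (rule Max_ge) auto
  have "m \<in> range (\<lambda>i. \<bar>x $ i\<bar>)"
    unfolding m_def by (rule Max_in) auto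
  then obtain i where i: "m = \<bar>x $ i\<bar>" by auto
  then have "m \<ge> 0" by simp
  \<comment> \<open>The hypothesis on \<open>x\<close> is applied just once, since \<open>x\<close>
    recurs on its right-hand side and simplification with it would loop.\<close>
  have "x $ i = a * (\<Sum>j\<in>UNIV. S $ i $ j * x $ j)"
    by (subst x) (simp add: matrix_vector_mult_def)
  then have "m = \<bar>a\<bar> * \<bar>\<Sum>j\<in>UNIV. S $ i $ j * x $ j\<bar>"
    by (simp add: i abs_mult)
  moreover have "\<bar>\<Sum>j\<in>UNIV. S $ i $ j * x $ j\<bar> \<le> (\<Sum>j\<in>UNIV. S $ i $ j * m)"
    by (rule order_trans[OF sum_abs])
      (auto intro!: sum_mono mult_left_mono simp: abs_mult nonneg le_m)
  moreover have "(\<Sum>j\<in>UNIV. S $ i $ j * m) \<le> m"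
    using mult_right_mono[OF row \<open>m \<ge> 0\<close>] by (simp add: sum_distrib_right)
  ultimately have "m \<le> \<bar>a\<bar> * m"
    using mult_left_mono[of "\<bar>\<Sum>j\<in>UNIV. S $ i $ j * x $ j\<bar>" m "\<bar>a\<bar>"] by linarith
  then have "m * (1 - \<bar>a\<bar>) \<le> 0" by (simp add: algebra_simps)
  with a have "m \<le> 0" by (simp add: mult_le_0_iff)
  have "x $ j = 0" for j
    using le_m[of j] \<open>m \<le> 0\<close> by simp
  then show ?thesis by (simp add: vec_eq_iff)
qed

text \<open>The preceding lemma says that this linear map has trivial kernel; in finite dimension,
  injectivity gives surjectivity.\<close>

lemma bij_substochastic_contraction:
  fixes S :: "real^'n^'n"
  assumes "\<And>i j. 0 \<le> S $ i $ j" and "\<And>i. (\<Sum>j\<in>UNIV. S $ i $ j) \<le> 1"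
    and "\<bar>a\<bar> < 1"
  shows "bij (\<lambda>x. x - a *\<^sub>R (S *v x))"
proof -
  have lin: "linear (\<lambda>x. x - a *\<^sub>R (S *v x))"
    by (intro linear_compose_sub linear_ident linear_compose_scale_right
        matrix_vector_mul_linear)
  have "inj (\<lambda>x. x - a *\<^sub>R (S *v x))"
    using substochastic_contraction_eq_0[OF assms]
    by (simp add: linear_injective_0[OF lin])
  then show ?thesis
    using linear_injective_imp_surjective[OF lin] by (simp add: bij_def)
qed

theorem theorem3:
  fixes S :: "real^'n^'n" and SB :: "real^'k^'n" and \<eta> :: "real^'k"
    and M T :: nat and lag :: "'n \<Rightarrow> 'n \<Rightarrow> nat \<Rightarrow> nat" and c1 c2 p :: real
  assumes "1 \<le> M" and "M \<le> T"
    and "\<And>k. 0 < \<eta> $ k \<and> \<eta> $ k \<le> 1"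
    and "\<And>i j. 0 \<le> S $ i $ j" and "\<And>i k. 0 \<le> SB $ i $ k"
    and "\<And>i. (\<Sum>j\<in>UNIV. S $ i $ j) + (\<Sum>k\<in>UNIV. SB $ i $ k) = 1"
    and "connected_network S SB"
    and "\<And>k. \<exists>i. SB $ i $ k > 0"
    and "c2 \<in> {- 1 / real M <..< 1 / real M} - {0}"
    and "\<And>m. m \<in> {0..M} \<Longrightarrow>
           max 0 (- c2 * real m) \<le> c1 \<and> c1 \<le> min 1 (1 - c2 * real m)"
    and "\<And>i j. strict_mono_on {1..M} (lag j i)"
    and "\<And>i j l. l \<in> {1..M} \<Longrightarrow> 1 \<le> lag j i l \<and> lag j i l \<le> T"
    and "p = c1 / (1 - c2 * real M)"
    and "\<exists>k. \<eta> $ k \<noteq> p"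
  shows "belief_fixed_point M lag c1 c2 S SB \<eta> - p *\<^sub>R (1 :: real^'n) = 0
           \<longleftrightarrow> SB *v (\<chi> k. \<eta> $ k - p) = 0"
proof -
  define a where "a = c2 * real M"
  define f where "f = (\<lambda>x. x - a *\<^sub>R (S *v x))"
  define b where "b = c1 *\<^sub>R (S *v 1) + SB *v \<eta>"
  have "\<bar>a\<bar> < 1"
    using \<open>1 \<le> M\<close> \<open>c2 \<in> _\<close> by (auto simp: a_def field_simps abs_less_iff)
  have row_le: "(\<Sum>j\<in>UNIV. S $ i $ j) \<le> 1" for i
    using assms(6)[of i] sum_nonneg[of UNIV "\<lambda>k. SB $ i $ k"] assms(5) by simp
  have "bij f"
    unfolding f_def using assms(4) row_le \<open>\<bar>a\<bar> < 1\<close> by (rule bij_substochastic_contraction)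
  have "belief_fixed_point M lag c1 c2 S SB \<eta> = (THE P. f P = b)"
    unfolding belief_fixed_point_def belief_recursion_const_iff[OF assms(11)]
    by (simp add: f_def a_def b_def)
  moreover have "\<exists>!P. f P = b"
    using \<open>bij f\<close> by (simp add: bij_iff)
  \<comment> \<open>Unique existence turns the definite description into an equation that a
    candidate \<open>P\<close> can be tested against.\<close>
  ultimately have fixed: "belief_fixed_point M lag c1 c2 S SB \<eta> = P \<longleftrightarrow> f P = b" for P
    using the1_equality[of "\<lambda>P. f P = b" P] theI'[of "\<lambda>P. f P = b"] by auto
  \<comment> \<open>The denominator \<open>1 - a\<close> in the definition of \<open>p\<close> is
    nonzero because \<open>\<bar>a\<bar> < 1\<close>.\<close>
  have "p = a * p + c1"
    using \<open>p = _\<close> \<open>\<bar>a\<bar> < 1\<close> by (simp add: a_def field_simps)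
  have SB_one: "SB *v 1 = 1 - S *v 1"
    using assms(6) by (auto simp: vec_eq_iff matrix_vector_mult_def algebra_simps)
  have "b - f (p *\<^sub>R 1) = (a * p + c1) *\<^sub>R (S *v 1) + SB *v \<eta> - p *\<^sub>R 1"
    by (simp add: b_def f_def algebra_simps)
  \<comment> \<open>The coefficient of \<open>S *v 1\<close> folds back to \<open>p\<close>, and
    \<open>S *v 1 - 1\<close> is \<open>- (SB *v 1)\<close> by the row sums; only bot terms
    remain.\<close>
  also have "\<dots> = SB *v \<eta> - p *\<^sub>R (SB *v 1)"
    unfolding \<open>p = a * p + c1\<close>[symmetric] by (simp add: SB_one scaleR_right_diff_distrib)
  also have "\<dots> = SB *v (\<eta> - p *\<^sub>R 1)"
    by (simp add: matrix_vector_mult_diff_distrib matrix_vector_mult_scaleR)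
  also have "\<eta> - p *\<^sub>R 1 = (\<chi> k. \<eta> $ k - p)"
    by (simp add: vec_eq_iff)
  finally have residual: "b - f (p *\<^sub>R 1) = SB *v (\<chi> k. \<eta> $ k - p)" .
  have "belief_fixed_point M lag c1 c2 S SB \<eta> - p *\<^sub>R 1 = 0 \<longleftrightarrow> f (p *\<^sub>R 1) = b"
    unfolding right_minus_eq by (rule fixed)
  also have "\<dots> \<longleftrightarrow> b - f (p *\<^sub>R 1) = 0"
    by (auto simp only: right_minus_eq)
  finally show ?thesis
    unfolding residual .
qed

end
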